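(* Let $M \in \mathbb{R}^{m \times n}_+$ be an entrywise nonnegative matrix of rank two such that the entries of each column of $M$ sum to one. Then the rank-two NMF algorithm described in the context, applied to $M$, computes an optimal rank-two NMF of $M$; that is, any pair $(W,H) \in \mathbb{R}^{m\times 2}_+ \times \mathbb{R}^{2 \times n}_+$ output by it satisfies $$\|M-WH\|_F^2 = \min_{P \in \mathbb{R}^{m \times 2},\, P \geq 0,\; Q \in \mathbb{R}^{2 \times n},\, Q \geq 0} \|M-PQ\|_F^2 .$$
   Context: Inequalities such as $P \ge 0$ between a matrix and zero are entrywise; $\mathbb{R}^{m\times n}_+$ is the set of entrywise nonnegative real $m \times n$ matrices; $\|\cdot\|_F$ is the Frobenius norm. $A(:,j)$ denotes the $j$-th column of $A$. The rank-two NMF algorithm takes as input $M \in \mathbb{R}^{m\times n}_+$ (with $m,n\ge 2$) and proceeds as follows (arbitrary choices are allowed whenever a minimizer, maximizer or SVD is not unique). 1. Compute a rank-two truncated singular value decomposition of $M$: $U \in \mathbb{R}^{m\times 2}$ with orthonormal columns (left singular vectors for the two largest singular values), $S \in \mathbb{R}^{2\times 2}$ diagonal with the two largest singular values $\sigma_1(M)\ge\sigma_2(M)$, and $V \in \mathbb{R}^{2\times n}$ with orthonormal rows (the corresponding right singular vectors), so that $USV$ is a best approximation of $M$ of rank at most two in Frobenius norm. 2. Let $X = SV = U^TM \in \mathbb{R}^{2\times n}$. 3. Extract two column indices $K=(k_1,k_2)$ from $X$ with the successive projection algorithm (SPA): choose $k_1 \in \operatorname{argmax}_j \|X(:,j)\|_2$;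 set $R = \left(I - \frac{X(:,k_1)X(:,k_1)^T}{\|X(:,k_1)\|_2^2}\right) X$; choose $k_2 \in \operatorname{argmax}_j \|R(:,j)\|_2$. 4. Let $W = \max(0, USV(:,K)) \in \mathbb{R}^{m \times 2}_+$, where the maximum is entrywise and $V(:,K)$ is the $2\times 2$ matrix with columns $V(:,k_1), V(:,k_2)$. 5. Let $H \in \operatorname{argmin}_{Y \in \mathbb{R}^{2\times n},\, Y \geq 0} \|M - WY\|_F^2$. Output $(W,H)$. *)

theory Defs
  imports "HOL-Analysis.Analysis"
begin

text \<open>
  The order on \<^typ>\<open>real^'n^'m\<close> is entrywise, so \<^prop>\<open>0 \<le> (M :: real^'n^'m)\<close> says that \<open>M\<close> is
  entrywise nonnegative. The two elements of the index type \<open>2\<close> are written \<open>1\<close> and \<open>2\<close>.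
\<close>

definition frobenius_norm :: "real^'n^'m \<Rightarrow> real" where
  "frobenius_norm A = sqrt (\<Sum>i\<in>UNIV. \<Sum>j\<in>UNIV. (A $ i $ j)\<^sup>2)"

lemma frobenius_norm_eq_norm: "frobenius_norm A = norm A"
  by (simp add: frobenius_norm_def norm_vec_def L2_set_def sum_nonneg)

definition outer_product :: "real^'m \<Rightarrow> real^'n \<Rightarrow> real^'n^'m" where
  "outer_product x y = (\<chi> i j. x $ i * y $ j)"

text \<open>
  Singular value decomposition \<open>M = \<Sum>k<p. \<sigma>\<^sub>k u\<^sub>k v\<^sub>k\<^sup>T\<close> with \<open>p = min m n\<close>. The indices start at \<open>0\<close>,
  so the two largest singular values are \<open>\<sigma> 0\<close> and \<open>\<sigma> 1\<close> (when \<open>p \<ge> 2\<close>); only the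
  values at indices below \<open>p\<close> are constrained.
\<close>

definition is_svd ::
    "real^'n^'m \<Rightarrow> (nat \<Rightarrow> real^'m) \<Rightarrow> (nat \<Rightarrow> real) \<Rightarrow> (nat \<Rightarrow> real^'n) \<Rightarrow> bool" where
  "is_svd M u \<sigma> v \<longleftrightarrow>
     (let p = min CARD('m) CARD('n) in
       (\<forall>k<p. \<forall>l<p. u k \<bullet> u l = (if k = l then 1 else 0)) \<and>
       (\<forall>k<p. \<forall>l<p. v k \<bullet> v l = (if k = l then 1 else 0)) \<and>
       (\<forall>k<p. 0 \<le> \<sigma> k) \<and>
       (\<forall>k<p. \<forall>l<p. k \<le> l \<longrightarrow> \<sigma> l \<le> \<sigma> k) \<and>
       M = (\<Sum>k<p. \<sigma> k *\<^sub>R outer_product (u k) (v k)))"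

definition is_truncated_svd2 ::
    "real^'n^'m \<Rightarrow> real^2^'m \<Rightarrow> real^2^2 \<Rightarrow> real^'n^2 \<Rightarrow> bool" where
  "is_truncated_svd2 M U S V \<longleftrightarrow>
     (\<exists>u \<sigma> v. is_svd M u \<sigma> v \<and>
       column 1 U = u 0 \<and> column 2 U = u 1 \<and>
       S $ 1 $ 1 = \<sigma> 0 \<and> S $ 2 $ 2 = \<sigma> 1 \<and> S $ 1 $ 2 = 0 \<and> S $ 2 $ 1 = 0 \<and>
       row 1 V = v 0 \<and> row 2 V = v 1)"

definition spa_residual :: "real^'n^2 \<Rightarrow> 'n \<Rightarrow> real^'n^2" where
  "spa_residual X k =
     (mat 1 - (1 / (norm (column k X))\<^sup>2) *\<^sub>R outer_product (column k X) (column k X)) ** X"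

definition spa2 :: "real^'n^2 \<Rightarrow> 'n^2 \<Rightarrow> bool" where
  "spa2 X K \<longleftrightarrow>
     is_arg_max (\<lambda>j. norm (column j X)) (\<lambda>j. True) (K $ 1) \<and>
     is_arg_max (\<lambda>j. norm (column j (spa_residual X (K $ 1)))) (\<lambda>j. True) (K $ 2)"

definition select_columns :: "real^'n^'m \<Rightarrow> 'n^'k \<Rightarrow> real^'k^'m" where
  "select_columns A K = (\<chi> i l. A $ i $ (K $ l))"

definition pos_part :: "real^'n^'m \<Rightarrow> real^'n^'m" where
  "pos_part A = (\<chi> i j. max 0 (A $ i $ j))"

definition rank2_nmf_output :: "real^'n^'m \<Rightarrow> real^2^'m \<Rightarrow> real^'n^2 \<Rightarrow> bool" where
  "rank2_nmf_output M W H \<longleftrightarrow>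
     (\<exists>U S V K. is_truncated_svd2 M U S V \<and> spa2 (S ** V) K \<and>
       W = pos_part (U ** S ** select_columns V K) \<and>
       is_arg_min (\<lambda>Y. (frobenius_norm (M - W ** Y))\<^sup>2) (\<lambda>Y. 0 \<le> Y) H)"

end

theory Submission
  imports Defs
begin

text \<open>
  A rank-two \<open>M\<close> equals its truncated SVD \<open>U S V\<close>, so \<open>W\<close> consists of two columns of \<open>M = U X\<close>.
  Since the columns of \<open>M\<close> sum to one, the columns of \<open>X\<close> lie on a line \<open>s \<bullet> x = 1\<close> in the plane,
  hence on a segment. Its farthest point from the origin is an endpoint, and the residual after
  projecting this endpoint away is proportional to the distance from it, so SPA finds both
  endpoints. Thus every column of \<open>M\<close> is a convex combination of the columns of \<open>W\<close>, and the
  optimal error is zero.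
\<close>

lemma outer_product_mult_vector: "outer_product x y *v z = (y \<bullet> z) *\<^sub>R x"
  by (simp add: vec_eq_iff outer_product_def matrix_vector_mult_def inner_vec_def
      sum_distrib_left sum_distrib_right ac_simps)

lemma sum_matrix_vector_mult:
  fixes A :: "'a \<Rightarrow> real^'n^'m"
  shows "(\<Sum>k\<in>I. A k) *v x = (\<Sum>k\<in>I. A k *v x)"
  by (induction I rule: infinite_finite_induct)
    (simp_all add: matrix_vector_mult_add_rdistrib)

text \<open>Orthonormality of the \<open>v k\<close> kills every term but the one at
  \<open>l\<close>. This places each \<open>u l\<close> with \<open>\<sigma> l \<noteq> 0\<close> in
  the range of \<open>M\<close>.\<close>

lemma is_svd_mult_right_singular_vector:
  assumes "is_svd M u \<sigma> v" and l: "l < min CARD('m) CARD('n)"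
  shows "(M :: real^'n^'m) *v v l = \<sigma> l *\<^sub>R u l"
proof -
  let ?p = "min CARD('m) CARD('n)"
  have M: "M = (\<Sum>k<?p. \<sigma> k *\<^sub>R outer_product (u k) (v k))"
    and v: "\<And>k. k < ?p \<Longrightarrow> v k \<bullet> v l = (if k = l then 1 else 0)"
    using assms unfolding is_svd_def Let_def by blast+
  have "M *v v l = (\<Sum>k<?p. (\<sigma> k * (v k \<bullet> v l)) *\<^sub>R u k)"
    unfolding M sum_matrix_vector_mult
    by (simp add: scaleR_matrix_vector_assoc[symmetric] outer_product_mult_vector)
  also have "\<dots> = (\<Sum>k<?p. if k = l then \<sigma> l *\<^sub>R u l else 0)"
    by (rule sum.cong) (auto simp: v)
  also have "\<dots> = \<sigma> l *\<^sub>R u l"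
    using l by (simp add: sum.delta)
  finally show ?thesis .
qed

text \<open>Otherwise the ordering makes \<open>\<sigma> 0, ..., \<sigma> l\<close> all positive, so
  the range of \<open>M\<close> contains the \<open>l + 1\<close> orthonormal vectors
  \<open>u 0, ..., u l\<close>, more than its dimension allows.\<close>

lemma is_svd_eq_zero_if_rank_le:
  assumes svd: "is_svd M u \<sigma> v" and l: "l < min CARD('m) CARD('n)"
    and rank: "rank (M :: real^'n^'m) \<le> l"
  shows "\<sigma> l = 0"
proof (rule ccontr)
  assume "\<sigma> l \<noteq> 0"
  let ?p = "min CARD('m) CARD('n)"
  have u: "\<And>j k. j < ?p \<Longrightarrow> k < ?p \<Longrightarrow> u j \<bullet> u k = (if j = k then 1 else 0)"
    and mono: "\<And>j. j \<le> l \<Longrightarrow> \<sigma> l \<le> \<sigma> j" and nonneg: "0 \<le> \<sigma> l"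
    using svd l unfolding is_svd_def Let_def by auto
  have pos: "\<sigma> j > 0" if "j \<le> l" for j
    using mono[OF that] nonneg \<open>\<sigma> l \<noteq> 0\<close> by linarith
  have inj: "inj_on u {..l}"
  proof (rule inj_onI)
    fix j k assume "j \<in> {..l}" "k \<in> {..l}" "u j = u k"
    then show "j = k"
      using u[of j k] u[of j j] l by (auto split: if_splits)
  qed
  have "independent (u ` {..l})"
  proof (rule pairwise_orthogonal_independent)
    show "pairwise orthogonal (u ` {..l})"
      using l by (auto simp: pairwise_def orthogonal_def u)
    show "0 \<notin> u ` {..l}"
    proof
      assume "0 \<in> u ` {..l}"
      then obtain j where "j \<le> l" "u j = 0" by auto
      then show False using u[of j j] l by auto
    qed
  qed
  moreover have "u ` {..l} \<subseteq> range ((*v) M)"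
  proof
    fix y assume "y \<in> u ` {..l}"
    then obtain j where j: "j \<le> l" "y = u j" by auto
    have "M *v ((1 / \<sigma> j) *\<^sub>R v j) = u j"
      using is_svd_mult_right_singular_vector[OF svd, of j] j l pos[of j]
      by (simp add: matrix_vector_mult_scaleR)
    then show "y \<in> range ((*v) M)" using j by (metis rangeI)
  qed
  ultimately have "card (u ` {..l}) \<le> dim (range ((*v) M))"
    by (metis independent_card_le_dim)
  then show False
    using rank inj by (simp add: card_image rank_dim_range)
qed

lemma truncated_svd2_eq_if_rank_two:
  assumes "is_truncated_svd2 M U S V" and rank: "rank (M :: real^'n^'m) = 2"
  shows "U ** S ** V = M"
proof -
  let ?p = "min CARD('m) CARD('n)"
  obtain u \<sigma> v where svd: "is_svd M u \<sigma> v"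
    and U: "column 1 U = u 0" "column 2 U = u 1"
    and S: "S $ 1 $ 1 = \<sigma> 0" "S $ 2 $ 2 = \<sigma> 1" "S $ 1 $ 2 = 0" "S $ 2 $ 1 = 0"
    and V: "row 1 V = v 0" "row 2 V = v 1"
    using assms(1) unfolding is_truncated_svd2_def by blast
  \<comment> \<open>This ensures that the indices 0 and 1 kept by the truncation occur in the full
    sum.\<close>
  have p: "2 \<le> ?p" using rank_bound[of M] rank by simp
  have zero: "\<sigma> k = 0" if "2 \<le> k" "k < ?p" for k
    using is_svd_eq_zero_if_rank_le[OF svd that(2)] rank that(1) by simp
  have "M = (\<Sum>k<?p. \<sigma> k *\<^sub>R outer_product (u k) (v k))"
    using svd unfolding is_svd_def Let_def by blast
  also have "\<dots> = (\<Sum>k<2. \<sigma> k *\<^sub>R outer_product (u k) (v k))"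
    using p by (intro sum.mono_neutral_right) (auto simp: zero)
  also have "\<dots> = \<sigma> 0 *\<^sub>R outer_product (u 0) (v 0) + \<sigma> 1 *\<^sub>R outer_product (u 1) (v 1)"
    by (simp add: numeral_2_eq_2)
  also have "\<dots> = U ** S ** V"
    unfolding U[symmetric] V[symmetric]
    by (simp add: vec_eq_iff matrix_matrix_mult_def sum_2 S outer_product_def column_def row_def)
  finally show ?thesis by simp
qed

lemma column_matrix_mult: "column j (A ** B) = A *v column j B"
  for A :: "real^'k^'m" and B :: "real^'n^'k"
  by (simp add: vec_eq_iff column_def matrix_matrix_mult_def matrix_vector_mult_def)

lemma column_spa_residual:
  "column j (spa_residual X k) =
    column j X - ((column k X \<bullet> column j X) / (norm (column k X))\<^sup>2) *\<^sub>R column k X"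
  by (simp add: spa_residual_def column_matrix_mult matrix_vector_mult_diff_rdistrib
      scaleR_matrix_vector_assoc[symmetric] outer_product_mult_vector)

text \<open>The direction is \<open>s\<close> turned by a right angle; it spans the orthogonal
  complement of \<open>s\<close>, where \<open>y - x\<close> lies.\<close>

lemma line_parametrization_real2:
  fixes s x y :: "real^2"
  assumes "s \<bullet> x = c" "s \<bullet> y = c" "s \<noteq> 0"
  shows "\<exists>t. y = x + t *\<^sub>R vector [- s $ 2, s $ 1]"
proof -
  define q where "q = (s $ 1)\<^sup>2 + (s $ 2)\<^sup>2"
  have q: "q \<noteq> 0"
    using assms(3) by (auto simp: q_def vec_eq_iff forall_2 sum_power2_eq_zero_iff)
  define a b where "a = y $ 1 - x $ 1" and "b = y $ 2 - x $ 2"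
  have ab: "s $ 1 * a + s $ 2 * b = 0"
    using assms(1,2) by (simp add: inner_vec_def sum_2 a_def b_def algebra_simps)
  \<comment> \<open>The coefficient of the orthogonal projection of \<open>(a, b)\<close> onto the
    direction, whose squared norm is \<open>q\<close>.\<close>
  define t where "t = (s $ 1 * b - s $ 2 * a) / q"
  have "q * a = - s $ 2 * (s $ 1 * b - s $ 2 * a)" "q * b = s $ 1 * (s $ 1 * b - s $ 2 * a)"
    using ab unfolding q_def by algebra+
  then have "a = t * - s $ 2" "b = t * s $ 1"
    using q by (simp_all add: t_def field_simps)
  then have "y = x + t *\<^sub>R vector [- s $ 2, s $ 1]"
    by (simp add: vec_eq_iff forall_2 a_def b_def algebra_simps)
  then show ?thesis ..
qed

text \<open>With the first chosen column \<open>x\<close> as origin of the line, column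
  \<open>j\<close> has a coordinate \<open>t j\<close>. Maximality of the norm of \<open>x\<close>
  gives all coordinates one sign, and the second choice maximizes \<open>\<bar>t j\<bar>\<close>;
  the weight is the quotient of coordinates.\<close>

lemma spa2_convex_combination:
  fixes X :: "real^'n^2"
  assumes spa: "spa2 X K" and s: "\<And>j. s \<bullet> column j X = 1"
  shows "\<exists>l. 0 \<le> l \<and> l \<le> 1 \<and>
    column j X = (1 - l) *\<^sub>R column (K $ 1) X + l *\<^sub>R column (K $ 2) X"
proof -
  define x where "x = column (K $ 1) X"
  define d :: "real^2" where "d = vector [- s $ 2, s $ 1]"
  have s0: "s \<noteq> 0" using s by force
  have sx: "s \<bullet> x = 1" by (simp add: x_def s)
  have d0: "d \<noteq> 0" using s0 by (auto simp: d_def vec_eq_iff forall_2)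
  have sd: "s \<bullet> d = 0" by (simp add: d_def inner_vec_def sum_2)
  have "\<exists>t. column j X = x + t *\<^sub>R d" for j
    unfolding d_def by (rule line_parametrization_real2[OF sx s s0])
  then obtain t where t: "\<And>j. column j X = x + t j *\<^sub>R d" by metis
  \<comment> \<open>The part of \<open>d\<close> orthogonal to \<open>x\<close>: projecting
    \<open>x\<close> away turns \<open>x + t j *\<^sub>R d\<close> into
    \<open>t j *\<^sub>R r\<close>.\<close>
  define r where "r = d - ((x \<bullet> d) / (norm x)\<^sup>2) *\<^sub>R x"
  have r0: "r \<noteq> 0"
  proof
    assume "r = 0"
    then have d: "d = ((x \<bullet> d) / (norm x)\<^sup>2) *\<^sub>R x" by (simp add: r_def)
    \<comment> \<open>Pairing with \<open>s\<close> reads off the multiple of \<open>x\<close>,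
      since \<open>s \<bullet> x = 1\<close>; but \<open>s \<bullet> d = 0\<close>.\<close>
    have "(x \<bullet> d) / (norm x)\<^sup>2 = s \<bullet> (((x \<bullet> d) / (norm x)\<^sup>2) *\<^sub>R x)"
      by (simp only: inner_scaleR_right sx mult_1_right)
    also have "\<dots> = 0"
      by (simp only: d[symmetric] sd)
    finally show False using d d0 by (simp only: scaleR_zero_left)
  qed
  have x0: "x \<noteq> 0" using sx by force
  have residual: "column j (spa_residual X (K $ 1)) = t j *\<^sub>R r" for j
    unfolding column_spa_residual x_def[symmetric] t[of j] r_def using x0
    by (simp add: inner_add_right power2_norm_eq_inner add_divide_distrib
        scaleR_add_left scaleR_diff_right)
  have max1: "norm (column j X) \<le> norm x" for j
    using spa by (simp add: spa2_def is_arg_max_linorder x_def)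
  have "norm (t j *\<^sub>R r) \<le> norm (t (K $ 2) *\<^sub>R r)" for j
    using spa by (simp add: spa2_def is_arg_max_linorder residual del: norm_scaleR)
  then have max2: "\<bar>t j\<bar> \<le> \<bar>t (K $ 2)\<bar>" for j
    using r0 by simp
  \<comment> \<open>The expanded difference of the squared norms of column \<open>j\<close> and
    \<open>x\<close>.\<close>
  have sign: "t j * (t j * (d \<bullet> d) + 2 * (x \<bullet> d)) \<le> 0" for j
  proof -
    have "(norm (x + t j *\<^sub>R d))\<^sup>2 \<le> (norm x)\<^sup>2"
      using max1[of j] by (simp add: t power_mono)
    then show ?thesis
      by (simp add: power2_norm_eq_inner inner_add_left inner_add_right inner_commute algebra_simps)
  qed
  have dd: "d \<bullet> d > 0" using d0 by simp
  \<comment> \<open>Coordinates of opposite signs would demand opposite signs of the single number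
    \<open>x \<bullet> d\<close>.\<close>
  have neg: "x \<bullet> d < 0" if "t j > 0" for j
    using sign[of j] that dd by (smt (verit) mult_pos_pos)
  have pos: "x \<bullet> d > 0" if "t j < 0" for j
    using sign[of j] that dd by (smt (verit) mult_neg_neg mult_neg_pos)
  \<comment> \<open>If \<open>t (K $ 2) = 0\<close>, all coordinates vanish by \<open>max2\<close>,
    and the value 0 of the division is a correct weight.\<close>
  define l where "l = t j / t (K $ 2)"
  have "0 \<le> l"
    unfolding l_def using neg[of j] neg[of "K $ 2"] pos[of j] pos[of "K $ 2"]
    by (smt (verit) divide_nonneg_nonneg divide_nonpos_nonpos)
  moreover have "\<bar>l\<bar> \<le> 1"
    unfolding l_def using max2[of j] by (simp add: divide_le_eq)
  moreover have "t j = l * t (K $ 2)"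
    using max2[of j] by (cases "t (K $ 2) = 0") (simp_all add: l_def)
  then have "column j X = (1 - l) *\<^sub>R x + l *\<^sub>R column (K $ 2) X"
    by (simp add: t algebra_simps)
  ultimately show ?thesis
    unfolding x_def by (intro exI[of _ l]) auto
qed

text \<open>The convex weights found for the columns of \<open>X\<close> carry over to those of
  \<open>M\<close> because \<open>U\<close> acts linearly; they form the columns of
  \<open>Q\<close>.\<close>

lemma spa2_exact_nmf:
  fixes M :: "real^'n^'m" and U :: "real^2^'m" and X :: "real^'n^2"
  assumes M: "M = U ** X" and sum: "\<And>j. (\<Sum>i\<in>UNIV. M $ i $ j) = 1" and spa: "spa2 X K"
  shows "\<exists>Q. 0 \<le> Q \<and> M = select_columns M K ** Q"
proof -
  have col: "column j M = U *v column j X" for j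
    by (simp add: M column_matrix_mult)
  \<comment> \<open>Here \<open>1\<close> is the all-ones vector, so the column sums of
    \<open>U ** X\<close> are inner products of the columns of \<open>X\<close> with
    \<open>transpose U *v 1\<close>, the normal of the line.\<close>
  have "(transpose U *v 1) \<bullet> column j X = 1" for j
  proof -
    have "(transpose U *v 1) \<bullet> column j X = 1 \<bullet> column j M"
      by (simp only: col transpose_matrix_vector dot_lmul_matrix)
    also have "\<dots> = 1"
      using sum[of j] by (simp add: inner_vec_def column_def)
    finally show ?thesis .
  qed
  then have "\<exists>l. 0 \<le> l \<and> l \<le> 1 \<and>
      column j X = (1 - l) *\<^sub>R column (K $ 1) X + l *\<^sub>R column (K $ 2) X" for j
    using spa2_convex_combination[OF spa] by blast
  then obtain l where l: "\<And>j. 0 \<le> l j" "\<And>j. l j \<le> 1"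
    "\<And>j. column j X = (1 - l j) *\<^sub>R column (K $ 1) X + l j *\<^sub>R column (K $ 2) X"
    by metis
  define Q :: "real^'n^2" where "Q = vector [\<chi> j. 1 - l j, \<chi> j. l j]"
  have Q0: "0 \<le> Q"
    by (simp add: Q_def less_eq_vec_def forall_2 l)
  have "M $ i $ j = (1 - l j) * M $ i $ (K $ 1) + l j * M $ i $ (K $ 2)" for i j
  proof -
    have "column j M = (1 - l j) *\<^sub>R column (K $ 1) M + l j *\<^sub>R column (K $ 2) M"
      by (simp only: col l(3)[of j] matrix_vector_right_distrib matrix_vector_mult_scaleR)
    then have "column j M $ i = ((1 - l j) *\<^sub>R column (K $ 1) M + l j *\<^sub>R column (K $ 2) M) $ i"
      by (rule arg_cong[where f = "\<lambda>x. x $ i"])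
    then show ?thesis by (simp add: column_def)
  qed
  moreover have "(select_columns M K ** Q) $ i $ j =
      (1 - l j) * M $ i $ (K $ 1) + l j * M $ i $ (K $ 2)" for i j
    by (simp add: select_columns_def matrix_matrix_mult_def Q_def sum_2)
  ultimately have "M = select_columns M K ** Q"
    unfolding vec_eq_iff by metis
  with Q0 show ?thesis by blast
qed

theorem theorem1:
  fixes M :: "real^'n^'m" and W :: "real^2^'m" and H :: "real^'n^2"
  assumes "0 \<le> M"
    and "rank M = 2"
    and "\<And>j. (\<Sum>i\<in>UNIV. M $ i $ j) = 1"
    and "rank2_nmf_output M W H"
  shows "is_arg_min (\<lambda>(P :: real^2^'m, Q :: real^'n^2). (frobenius_norm (M - P ** Q))\<^sup>2)
           (\<lambda>(P, Q). 0 \<le> P \<and> 0 \<le> Q) (W, H)"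
proof -
  obtain U S V K where svd: "is_truncated_svd2 M U S V" and spa: "spa2 (S ** V) K"
    and W: "W = pos_part (U ** S ** select_columns V K)"
    and H: "is_arg_min (\<lambda>Y. (frobenius_norm (M - W ** Y))\<^sup>2) (\<lambda>Y. 0 \<le> Y) H"
    using assms(4) unfolding rank2_nmf_output_def by blast
  have M: "U ** S ** V = M"
    using truncated_svd2_eq_if_rank_two[OF svd assms(2)] .
  have "U ** S ** select_columns V K = select_columns M K"
    unfolding M[symmetric] by (simp add: vec_eq_iff select_columns_def matrix_matrix_mult_def)
  \<comment> \<open>The selected columns of \<open>M\<close> are already nonnegative, so
    \<open>pos_part\<close> leaves them unchanged.\<close>
  then have W: "W = select_columns M K" and W0: "0 \<le> W"
    using assms(1) by (simp_all add: W pos_part_def select_columns_def vec_eq_iff less_eq_vec_def)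
  obtain Q where Q: "0 \<le> Q" "M = W ** Q"
    using spa2_exact_nmf[OF _ assms(3) spa] M unfolding W by (metis matrix_mul_assoc)
  \<comment> \<open>\<open>Q\<close> competes with \<open>H\<close> and has error zero, which no
    pair \<open>(P, Q)\<close> can beat.\<close>
  have H0: "0 \<le> H" and "(frobenius_norm (M - W ** H))\<^sup>2 \<le> (frobenius_norm (M - W ** Q))\<^sup>2"
    using H Q(1) by (simp_all add: is_arg_min_linorder)
  then have "(frobenius_norm (M - W ** H))\<^sup>2 = 0"
    using Q(2) by (simp add: frobenius_norm_eq_norm)
  then show ?thesis
    using W0 H0 by (auto simp: is_arg_min_linorder)
qed

end
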